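(* Let $L=\{L(x,y);x,y\ge0\}$ be a Lévy sheet with exponent $\Psi(\xi)=a(\xi)+ib(\xi)$, let $\theta\in(0,2\pi)$ be such that $a(\theta)a(2\theta)\ne0$, let $K=\frac1{\sqrt2}\frac{a(\theta)^2+b(\theta)^2}{a(\theta)}$, and for $n\in\mathbb{N}$, $(x,y)\in[0,1]^2$ put $$\theta^1_n(x,y)=nK\sqrt{xy}\cos\big(\theta L(\sqrt nx,\sqrt ny)\big),\qquad \theta^2_n(x,y)=nK\sqrt{xy}\sin\big(\theta L(\sqrt nx,\sqrt ny)\big).$$ Then for any $f,g\in L^2([0,1])$, any $n\in\mathbb{N}$ and $k\in\{1,2\}$, $$E\left(\int_{[0,1]^2}f(x)g(y)\theta_n^k(x,y)\,dx\,dy\right)^2\le\frac{136}{a^2(\theta)}K^2\int_{[0,1]^2}f(x)^2g(y)^2\,dx\,dy .$$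
   Context: A Lévy sheet with exponent $\Psi$ is a real-valued random field $L=\{L(s,t);s,t\ge0\}$, continuous in probability, vanishing on the axes, such that increments over disjoint rectangles of $\mathbb{R}_+^2$ are independent and, for every rectangle $Q\subset\mathbb{R}_+^2$ with increment $\Delta_QL$, $E[e^{i\xi\Delta_QL}]=e^{-\lambda(Q)\Psi(\xi)}$ for $\xi\in\mathbb{R}$, where $\lambda$ is Lebesgue measure. (A jointly measurable version is used so that the integrals make sense.) By the Lévy–Khintchine formula, $\Psi=a+ib$ with $a(\xi)=\frac12\sigma^2\xi^2+\int_{\mathbb{R}}[1-\cos(\xi x)]\eta(dx)\ge 0$ and $b(\xi)=a_0\xi+\int_{\mathbb{R}}\left[\frac{x\xi}{1+|x|^2}-\sin(\xi x)\right]\eta(dx)$, where $a_0\in\mathbb{R}$, $\sigma\ge0$ and $\eta$ is a Borel measure on $\mathbb{R}\setminus\{0\}$ with $\int\frac{|x|^2}{1+|x|^2}\eta(dx)<\infty$. Here $a^2(\theta)=a(\theta)^2$. *)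

theory Defs
  imports "HOL-Probability.Probability"
begin

section \<open>Levy sheets\<close>

abbreviation quadrant :: "(real \<times> real) set" where
  "quadrant \<equiv> {0..} \<times> {0..}"

text \<open>A rectangle is represented by its lower left and upper right corner. It is taken half-open,
  so that adjacent rectangles are disjoint.\<close>

fun rect :: "(real \<times> real) \<times> (real \<times> real) \<Rightarrow> (real \<times> real) set" where
  "rect ((s, t), (s', t')) = {s<..s'} \<times> {t<..t'}"

fun is_quadrant_rect :: "(real \<times> real) \<times> (real \<times> real) \<Rightarrow> bool" where
  "is_quadrant_rect ((s, t), (s', t')) \<longleftrightarrow> 0 \<le> s \<and> s < s' \<and> 0 \<le> t \<and> t < t'"

fun rect_increment ::
  "(real \<times> real \<Rightarrow> 'a \<Rightarrow> real) \<Rightarrow> (real \<times> real) \<times> (real \<times> real) \<Rightarrow> 'a \<Rightarrow> real" where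
  "rect_increment L ((s, t), (s', t')) \<omega> = L (s', t') \<omega> - L (s, t') \<omega> - L (s', t) \<omega> + L (s, t) \<omega>"

text \<open>The values of \<open>L\<close> outside the quadrant are irrelevant. Vanishing on the axes is only required
  almost surely at each point, so that the notion is stable under passing to a modification (such
  as a jointly measurable one).\<close>

locale levy_sheet = prob_space M
  for M :: "'a measure" and L :: "real \<times> real \<Rightarrow> 'a \<Rightarrow> real" and \<Psi> :: "real \<Rightarrow> complex" +
  assumes random_field: "p \<in> quadrant \<Longrightarrow> random_variable borel (L p)"
    and continuous_in_probability:
      "p \<in> quadrant \<Longrightarrow> \<epsilon> > 0 \<Longrightarrow>
        ((\<lambda>q. prob {\<omega> \<in> space M. \<bar>L q \<omega> - L p \<omega>\<bar> > \<epsilon>}) \<longlongrightarrow> 0) (at p within quadrant)"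
    and vanishes_on_axes:
      "s \<ge> 0 \<Longrightarrow> AE \<omega> in M. L (s, 0) \<omega> = 0"
      "t \<ge> 0 \<Longrightarrow> AE \<omega> in M. L (0, t) \<omega> = 0"
    and independent_increments:
      "finite R \<Longrightarrow> (\<And>Q. Q \<in> R \<Longrightarrow> is_quadrant_rect Q) \<Longrightarrow> disjoint_family_on rect R \<Longrightarrow>
        indep_vars (\<lambda>_. borel) (rect_increment L) R"
    and increment_char:
      "is_quadrant_rect Q \<Longrightarrow>
        expectation (\<lambda>\<omega>. exp (\<i> * complex_of_real (\<xi> * rect_increment L Q \<omega>)))
          = exp (- complex_of_real (measure lborel (rect Q)) * \<Psi> \<xi>)"

definition jointly_measurable :: "'a measure \<Rightarrow> (real \<times> real \<Rightarrow> 'a \<Rightarrow> real) \<Rightarrow> bool" where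
  "jointly_measurable M L \<longleftrightarrow>
    (\<lambda>(p, \<omega>). L p \<omega>) \<in> borel_measurable (restrict_space borel quadrant \<Otimes>\<^sub>M M)"


section \<open>The Levy-Khintchine representation\<close>

definition levy_measure :: "real measure \<Rightarrow> bool" where
  "levy_measure \<eta> \<longleftrightarrow>
    sets \<eta> = sets (restrict_space borel (UNIV - {0})) \<and>
    (\<integral>\<^sup>+ x. ennreal (\<bar>x\<bar>\<^sup>2 / (1 + \<bar>x\<bar>\<^sup>2)) \<partial>\<eta>) < \<infinity>"

definition levy_khintchine_re :: "real \<Rightarrow> real measure \<Rightarrow> real \<Rightarrow> real" where
  "levy_khintchine_re \<sigma> \<eta> \<xi> = 1 / 2 * \<sigma>\<^sup>2 * \<xi>\<^sup>2 + (LINT x|\<eta>. 1 - cos (\<xi> * x))"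

definition levy_khintchine_im :: "real \<Rightarrow> real measure \<Rightarrow> real \<Rightarrow> real" where
  "levy_khintchine_im a\<^sub>0 \<eta> \<xi> =
    a\<^sub>0 * \<xi> + (LINT x|\<eta>. x * \<xi> / (1 + \<bar>x\<bar>\<^sup>2) - sin (\<xi> * x))"


section \<open>The approximating processes\<close>

definition square_integrable_01 :: "(real \<Rightarrow> real) \<Rightarrow> bool" where
  "square_integrable_01 f \<longleftrightarrow>
    f \<in> borel_measurable (lebesgue_on {0..1}) \<and> integrable (lebesgue_on {0..1}) (\<lambda>x. (f x)\<^sup>2)"

definition theta_process ::
  "real \<Rightarrow> real \<Rightarrow> (real \<times> real \<Rightarrow> 'a \<Rightarrow> real) \<Rightarrow> nat \<Rightarrow> nat \<Rightarrow> real \<Rightarrow> real \<Rightarrow> 'a \<Rightarrow> real" where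
  "theta_process K \<theta> L k n x y \<omega> =
    real n * K * sqrt (x * y) *
      (if k = 1 then cos else sin) (\<theta> * L (sqrt (real n) * x, sqrt (real n) * y) \<omega>)"

end

theory Submission
  imports Defs "HOL-Real_Asymp.Real_Asymp"
begin

text \<open>Expanding the square, the second moment is a quadruple integral of
  \<open>f x * g y * f x' * g y' * sqrt (x y x' y')\<close> against the correlation of \<open>cos\<close> (or \<open>sin\<close>) of
  \<open>\<theta> L\<close> at two points, so everything depends on how fast this correlation decays and on how the
  decay is integrated.

  For the decay, let \<open>p \<le> P\<close> and \<open>q \<le> Q\<close> be the ordered coordinates of the two points. The
  correlation is controlled by the characteristic functions at \<open>\<theta>\<close> of the sum and of the
  difference of the two values of \<open>L\<close>. Both are combinations of independent increments of \<open>L\<close>, in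
  which the rectangles \<open>(p, P] \<times> (0, q]\<close> and \<open>(0, p] \<times> (q, Q]\<close> always have coefficient \<open>\<plusminus>1\<close>. The
  other rectangles contribute factors of modulus at most one, so the correlation is at most
  \<open>exp (- a(\<theta>) (q (P - p) + p (Q - q)))\<close> (lemma \<open>trig_correlation_le\<close>). After rescaling by
  \<open>sqrt n\<close> the constant in the exponent is \<open>c = n a(\<theta>)\<close>.

  For the integration, whatever the relative position of the points, the product form of the test
  function permits to regroup \<open>f x * f x' * g y * g y'\<close> as \<open>f p * g q\<close> times \<open>f P * g Q\<close>. The
  inequality \<open>\<bar>s t\<bar> \<le> s\<^sup>2 + t\<^sup>2\<close> separates the two corners \<open>(p, q)\<close> and \<open>(P, Q)\<close>, with weights \<open>p q\<close>
  and \<open>P Q\<close>. The exponential, integrated over the upper right corner and multiplied by \<open>p q\<close>,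
  gives exactly \<open>1 / c\<^sup>2\<close>; integrated over the lower left corner and multiplied by \<open>P Q\<close>, it gives
  at most \<open>8 / c\<^sup>2\<close> (lemmas \<open>decay_integral_upper\<close> and \<open>decay_integral_lower\<close>). The four ways of
  ordering the coordinates lead to the constant \<open>4 * 9 = 36\<close> (lemma \<open>kernel_form_le\<close>), and the
  factor \<open>n\<^sup>2\<close> of the process cancels \<open>n\<^sup>2\<close> in \<open>c\<^sup>2\<close>.\<close>


section \<open>Decay of correlations of a Levy sheet\<close>

lemma measure_rect:
  assumes "is_quadrant_rect ((s, t), (s', t'))"
  shows "measure lborel (rect ((s, t), (s', t'))) = (s' - s) * (t' - t)"
proof -
  have "emeasure lborel ({s<..s'} \<times> {t<..t'}) = ennreal (s' - s) * ennreal (t' - t)"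
    using assms by (simp add: lborel_prod[symmetric] lborel.emeasure_pair_measure_Times)
  then show ?thesis
    using assms by (simp add: measure_def enn2real_mult)
qed

lemma (in levy_sheet) rect_increment_measurable:
  assumes "is_quadrant_rect Q"
  shows "random_variable borel (rect_increment L Q)"
proof -
  obtain s t s' t' where Q: "Q = ((s, t), (s', t'))"
    by (metis surj_pair)
  have "rect_increment L Q = (\<lambda>\<omega>. L (s', t') \<omega> - L (s, t') \<omega> - L (s', t) \<omega> + L (s, t) \<omega>)"
    by (simp add: Q fun_eq_iff)
  moreover have "\<dots> \<in> borel_measurable M"
    using assms by (auto simp: Q intro!: borel_measurable_add borel_measurable_diff random_field)
  ultimately show ?thesis by simp
qed

lemma (in levy_sheet) norm_increment_char:
  assumes "is_quadrant_rect Q"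
  shows "norm (expectation (\<lambda>\<omega>. exp (\<i> * complex_of_real (\<xi> * rect_increment L Q \<omega>))))
    = exp (- measure lborel (rect Q) * Re (\<Psi> \<xi>))"
  by (simp add: increment_char[OF assms] norm_exp_eq_Re del: of_real_mult)

lemma (in prob_space) norm_expectation_exp_ii_le_1:
  "norm (expectation (\<lambda>\<omega>. exp (\<i> * complex_of_real (X \<omega>)))) \<le> 1"
proof -
  have "norm (expectation (\<lambda>\<omega>. exp (\<i> * complex_of_real (X \<omega>)))) \<le>
     expectation (\<lambda>\<omega>. norm (exp (\<i> * complex_of_real (X \<omega>))))"
    by (rule integral_norm_bound)
  then show ?thesis by (simp add: prob_space)
qed

text \<open>Independence factorises the characteristic function over the rectangles of \<open>R\<close>. Every factor has
  modulus at most one, so any selection \<open>S\<close> of them already bounds the modulus of the product.\<close>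

lemma (in levy_sheet) norm_char_combination_le:
  assumes fin: "finite R" and rects: "\<And>Q. Q \<in> R \<Longrightarrow> is_quadrant_rect Q"
    and disj: "disjoint_family_on rect R" and sub: "S \<subseteq> R"
  shows "norm (expectation (\<lambda>\<omega>. exp (\<i> * complex_of_real (\<Sum>Q\<in>R. c Q * rect_increment L Q \<omega>))))
    \<le> (\<Prod>Q\<in>S. exp (- measure lborel (rect Q) * Re (\<Psi> (c Q))))"
proof -
  let ?e = "\<lambda>Q \<omega>. exp (\<i> * complex_of_real (c Q * rect_increment L Q \<omega>))"
  have meas: "?e Q \<in> borel_measurable M" if "Q \<in> R" for Q
    using rect_increment_measurable[OF rects[OF that]] by measurable
  have "indep_vars (\<lambda>_. borel) (\<lambda>Q. rect_increment L Q) R"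
    using independent_increments[OF fin rects disj] by simp
  then have ind: "indep_vars (\<lambda>_. borel) ?e R"
    by (rule indep_vars_compose2) measurable
  have int: "integrable M (?e Q)" if "Q \<in> R" for Q
    by (rule integrable_const_bound[where B = 1]) (use meas[OF that] in auto)
  have "expectation (\<lambda>\<omega>. exp (\<i> * complex_of_real (\<Sum>Q\<in>R. c Q * rect_increment L Q \<omega>)))
      = expectation (\<lambda>\<omega>. \<Prod>Q\<in>R. ?e Q \<omega>)"
    by (simp add: exp_sum[OF fin, symmetric] sum_distrib_left)
  also have "\<dots> = (\<Prod>Q\<in>R. expectation (?e Q))"
    by (rule indep_vars_lebesgue_integral[OF fin ind int])
  also have "norm \<dots> = (\<Prod>Q\<in>R. norm (expectation (?e Q)))"
    by (rule prod_norm[symmetric])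
  also have "\<dots> = (\<Prod>Q\<in>R - S. norm (expectation (?e Q))) * (\<Prod>Q\<in>S. norm (expectation (?e Q)))"
    by (rule prod.subset_diff[OF sub fin])
  also have "\<dots> \<le> 1 * (\<Prod>Q\<in>S. norm (expectation (?e Q)))"
    by (intro mult_right_mono prod_le_1 prod_nonneg conjI norm_ge_zero norm_expectation_exp_ii_le_1 ballI)
  also have "\<dots> = (\<Prod>Q\<in>S. exp (- measure lborel (rect Q) * Re (\<Psi> (c Q))))"
    unfolding mult_1 by (intro prod.cong refl norm_increment_char rects) (use sub in auto)
  finally show ?thesis .
qed

text \<open>The points \<open>(p, q)\<close>, \<open>(P, q)\<close>, \<open>(p, Q)\<close>, \<open>(P, Q)\<close> and the axes cut \<open>(0, P] \<times> (0, Q]\<close> into four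
  rectangles, and the hypothesis on \<open>X\<close> says that \<open>X\<close> is the combination of their increments with
  coefficients \<open>\<alpha>\<close> (lower left), \<open>\<beta>\<close> (lower right), \<open>\<gamma>\<close> (upper left) and \<open>\<delta>\<close> (upper right). The
  bound keeps only the two off-diagonal rectangles, whose total area is \<open>q (P - p) + p (Q - q)\<close>.\<close>

lemma (in levy_sheet) norm_char_grid_le:
  assumes "0 < p" "p < P" "0 < q" "q < Q"
    and "Re (\<Psi> \<beta>) = r" "Re (\<Psi> \<gamma>) = r"
    and [measurable]: "random_variable borel X"
    and X: "AE \<omega> in M. X \<omega> = \<alpha> * L (p, q) \<omega> + \<beta> * (L (P, q) \<omega> - L (p, q) \<omega>)
          + \<gamma> * (L (p, Q) \<omega> - L (p, q) \<omega>)
          + \<delta> * (L (P, Q) \<omega> - L (P, q) \<omega> - L (p, Q) \<omega> + L (p, q) \<omega>)"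
  shows "norm (expectation (\<lambda>\<omega>. exp (\<i> * complex_of_real (X \<omega>))))
      \<le> exp (- r * (q * (P - p) + p * (Q - q)))"
proof -
  let ?A = "((0, 0), (p, q))" and ?B = "((p, 0), (P, q))"
    and ?C = "((0, q), (p, Q))" and ?D = "((p, q), (P, Q))"
  define c where "c = (\<lambda>_. 0)(?A := \<alpha>, ?B := \<beta>, ?C := \<gamma>, ?D := \<delta>)"
  define R where "R = {?A, ?B, ?C, ?D}"
  have rects: "is_quadrant_rect T" if "T \<in> R" for T
    using that assms(1-4) by (auto simp: R_def)
  have disj: "disjoint_family_on rect R"
    using assms(1-4) by (auto simp: R_def disjoint_family_on_def)
  let ?Y = "\<lambda>\<omega>. \<Sum>T\<in>R. c T * rect_increment L T \<omega>"
  have [measurable]: "?Y \<in> borel_measurable M"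
    using rects by (intro borel_measurable_sum borel_measurable_times borel_measurable_const
      rect_increment_measurable) auto
  have Y: "?Y \<omega> = \<alpha> * rect_increment L ?A \<omega> + \<beta> * rect_increment L ?B \<omega>
     + \<gamma> * rect_increment L ?C \<omega> + \<delta> * rect_increment L ?D \<omega>" for \<omega>
    using assms(1-4) by (simp add: R_def c_def del: rect_increment.simps)
  \<comment> \<open>The sheet vanishes on the axes, so each \<open>L (x, y)\<close> is the sum of the increments below \<open>(x, y)\<close>.\<close>
  have "AE \<omega> in M. X \<omega> = ?Y \<omega>"
  proof -
    have "AE \<omega> in M. L (s, 0) \<omega> = 0" if "s \<in> {0, p, P}" for s
      using that assms(1-4) by (intro vanishes_on_axes) auto
    moreover have "AE \<omega> in M. L (0, t) \<omega> = 0" if "t \<in> {q, Q}" for t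
      using that assms(1-4) by (intro vanishes_on_axes) auto
    ultimately have "AE \<omega> in M. L (0, 0) \<omega> = 0" "AE \<omega> in M. L (p, 0) \<omega> = 0"
      "AE \<omega> in M. L (P, 0) \<omega> = 0" "AE \<omega> in M. L (0, q) \<omega> = 0" "AE \<omega> in M. L (0, Q) \<omega> = 0"
      by blast+
    with X show ?thesis
      unfolding Y by eventually_elim simp
  qed
  then have "expectation (\<lambda>\<omega>. exp (\<i> * complex_of_real (X \<omega>)))
     = expectation (\<lambda>\<omega>. exp (\<i> * complex_of_real (?Y \<omega>)))"
    by (intro integral_cong_AE) (auto simp del: of_real_sum)
  also have "norm \<dots> \<le> (\<Prod>T\<in>{?B, ?C}. exp (- measure lborel (rect T) * Re (\<Psi> (c T))))"
    by (rule norm_char_combination_le[OF _ rects disj]) (auto simp: R_def)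
  also have "\<dots> = exp (- ((P - p) * q) * r) * exp (- (p * (Q - q)) * r)"
    using assms(1-6) by (simp add: c_def measure_rect del: rect.simps)
  also have "\<dots> = exp (- r * (q * (P - p) + p * (Q - q)))"
    by (simp add: exp_add[symmetric] algebra_simps)
  finally show ?thesis .
qed

text \<open>By the product-to-sum formulas, \<open>cos U cos V\<close> and \<open>sin U sin V\<close> are half the sum and half the
  difference of \<open>cos (U - V)\<close> and \<open>cos (U + V)\<close>.\<close>

lemma (in prob_space) abs_expectation_trig_product_le:
  fixes U V :: "'a \<Rightarrow> real"
  assumes [measurable]: "random_variable borel U" "random_variable borel V"
    and "norm (expectation (\<lambda>\<omega>. exp (\<i> * complex_of_real (U \<omega> - V \<omega>)))) \<le> B"
    and "norm (expectation (\<lambda>\<omega>. exp (\<i> * complex_of_real (U \<omega> + V \<omega>)))) \<le> B"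
    and trig: "trig \<in> {cos, sin}"
  shows "\<bar>expectation (\<lambda>\<omega>. trig (U \<omega>) * trig (V \<omega>))\<bar> \<le> B"
proof -
  have Ecos: "integrable M (\<lambda>\<omega>. cos (X \<omega>))"
    "\<bar>expectation (\<lambda>\<omega>. cos (X \<omega>))\<bar> \<le> norm (expectation (\<lambda>\<omega>. exp (\<i> * complex_of_real (X \<omega>))))"
    if [measurable]: "random_variable borel X" for X :: "'a \<Rightarrow> real"
  proof -
    have "integrable M (\<lambda>\<omega>. exp (\<i> * complex_of_real (X \<omega>)))"
      by (rule integrable_const_bound[where B = 1]) auto
    then have "expectation (\<lambda>\<omega>. Re (exp (\<i> * complex_of_real (X \<omega>))))
      = Re (expectation (\<lambda>\<omega>. exp (\<i> * complex_of_real (X \<omega>))))"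
      by (rule integral_Re)
    then have "expectation (\<lambda>\<omega>. cos (X \<omega>)) = Re (expectation (\<lambda>\<omega>. exp (\<i> * complex_of_real (X \<omega>))))"
      by (simp add: Re_exp)
    then show "\<bar>expectation (\<lambda>\<omega>. cos (X \<omega>))\<bar> \<le> norm (expectation (\<lambda>\<omega>. exp (\<i> * complex_of_real (X \<omega>))))"
      using abs_Re_le_cmod by simp
    show "integrable M (\<lambda>\<omega>. cos (X \<omega>))"
      by (rule integrable_const_bound[where B = 1]) auto
  qed
  have diff: "integrable M (\<lambda>\<omega>. cos (U \<omega> - V \<omega>))" "\<bar>expectation (\<lambda>\<omega>. cos (U \<omega> - V \<omega>))\<bar> \<le> B"
    and add: "integrable M (\<lambda>\<omega>. cos (U \<omega> + V \<omega>))" "\<bar>expectation (\<lambda>\<omega>. cos (U \<omega> + V \<omega>))\<bar> \<le> B"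
    using Ecos[of "\<lambda>\<omega>. U \<omega> - V \<omega>"] Ecos[of "\<lambda>\<omega>. U \<omega> + V \<omega>"] assms(3,4) by auto
  have half: "\<bar>(s + t) / 2\<bar> \<le> B" "\<bar>(s - t) / 2\<bar> \<le> B" if "\<bar>s\<bar> \<le> B" "\<bar>t\<bar> \<le> B" for s t
    using that by (auto simp: abs_le_iff field_simps)
  show ?thesis
  proof (cases "trig = cos")
    case True
    have "expectation (\<lambda>\<omega>. trig (U \<omega>) * trig (V \<omega>))
      = (expectation (\<lambda>\<omega>. cos (U \<omega> - V \<omega>)) + expectation (\<lambda>\<omega>. cos (U \<omega> + V \<omega>))) / 2"
      unfolding True cos_times_cos
      by (simp only: integral_divide_zero Bochner_Integration.integral_add[OF diff(1) add(1)])
    then show ?thesis using half(1)[OF diff(2) add(2)] by simp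
  next
    case False
    then have "trig = sin" using trig by auto
    then have "expectation (\<lambda>\<omega>. trig (U \<omega>) * trig (V \<omega>))
      = (expectation (\<lambda>\<omega>. cos (U \<omega> - V \<omega>)) - expectation (\<lambda>\<omega>. cos (U \<omega> + V \<omega>))) / 2"
      unfolding sin_times_sin
      by (simp only: sin_times_sin integral_divide_zero Bochner_Integration.integral_diff[OF diff(1) add(1)])
    then show ?thesis using half(2)[OF diff(2) add(2)] by simp
  qed
qed

text \<open>In \<open>L (x, y) \<plusminus> L (x', y')\<close> each of the two off-diagonal rectangles of the grid generated by the
  two points lies below exactly one of them, so its increment occurs with coefficient \<open>1\<close> or \<open>-1\<close>.
  Hence one exponential bound, with the real part \<open>r\<close> of the exponent at \<open>\<plusminus>\<theta>\<close>, serves the sum and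
  the difference at the same time, in every relative position of the points.\<close>

lemma (in levy_sheet) trig_correlation_le:
  assumes pos: "0 < x" "0 < y" "0 < x'" "0 < y'" and ne: "x \<noteq> x'" "y \<noteq> y'"
    and r: "Re (\<Psi> \<theta>) = r" "Re (\<Psi> (- \<theta>)) = r"
    and trig: "trig \<in> {cos, sin}"
  shows "\<bar>expectation (\<lambda>\<omega>. trig (\<theta> * L (x, y) \<omega>) * trig (\<theta> * L (x', y') \<omega>))\<bar>
    \<le> exp (- r * (min y y' * \<bar>x - x'\<bar> + min x x' * \<bar>y - y'\<bar>))"
proof -
  have meas: "random_variable borel (L (s, t))" if "0 < s" "0 < t" for s t
    using that by (intro random_field) auto
  have diag: "\<bar>expectation (\<lambda>\<omega>. trig (\<theta> * L (p, q) \<omega>) * trig (\<theta> * L (P, Q) \<omega>))\<bar>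
      \<le> exp (- r * (q * (P - p) + p * (Q - q)))"
   and anti: "\<bar>expectation (\<lambda>\<omega>. trig (\<theta> * L (P, q) \<omega>) * trig (\<theta> * L (p, Q) \<omega>))\<bar>
      \<le> exp (- r * (q * (P - p) + p * (Q - q)))"
    if *: "0 < p" "p < P" "0 < q" "q < Q" for p P q Q
  proof -
    have **: "0 < P" "0 < Q" using * by auto
    note [measurable] = meas[OF *(1,3)] meas[OF *(1) **(2)] meas[OF **(1) *(3)] meas[OF **]
    show "\<bar>expectation (\<lambda>\<omega>. trig (\<theta> * L (p, q) \<omega>) * trig (\<theta> * L (P, Q) \<omega>))\<bar>
      \<le> exp (- r * (q * (P - p) + p * (Q - q)))"
    proof (rule abs_expectation_trig_product_le[OF _ _ _ _ trig])
      show "norm (expectation (\<lambda>\<omega>. exp (\<i> * complex_of_real (\<theta> * L (p, q) \<omega> - \<theta> * L (P, Q) \<omega>))))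
         \<le> exp (- r * (q * (P - p) + p * (Q - q)))"
        by (rule norm_char_grid_le[OF *, where \<alpha> = 0 and \<beta> = "- \<theta>" and \<gamma> = "- \<theta>" and \<delta> = "- \<theta>"])
          (auto simp: r algebra_simps)
      show "norm (expectation (\<lambda>\<omega>. exp (\<i> * complex_of_real (\<theta> * L (p, q) \<omega> + \<theta> * L (P, Q) \<omega>))))
         \<le> exp (- r * (q * (P - p) + p * (Q - q)))"
        by (rule norm_char_grid_le[OF *, where \<alpha> = "2 * \<theta>" and \<beta> = \<theta> and \<gamma> = \<theta> and \<delta> = \<theta>])
          (auto simp: r algebra_simps)
    qed measurable
    show "\<bar>expectation (\<lambda>\<omega>. trig (\<theta> * L (P, q) \<omega>) * trig (\<theta> * L (p, Q) \<omega>))\<bar>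
      \<le> exp (- r * (q * (P - p) + p * (Q - q)))"
    proof (rule abs_expectation_trig_product_le[OF _ _ _ _ trig])
      show "norm (expectation (\<lambda>\<omega>. exp (\<i> * complex_of_real (\<theta> * L (P, q) \<omega> - \<theta> * L (p, Q) \<omega>))))
         \<le> exp (- r * (q * (P - p) + p * (Q - q)))"
        by (rule norm_char_grid_le[OF *, where \<alpha> = 0 and \<beta> = \<theta> and \<gamma> = "- \<theta>" and \<delta> = 0])
          (auto simp: r algebra_simps)
      show "norm (expectation (\<lambda>\<omega>. exp (\<i> * complex_of_real (\<theta> * L (P, q) \<omega> + \<theta> * L (p, Q) \<omega>))))
         \<le> exp (- r * (q * (P - p) + p * (Q - q)))"
        by (rule norm_char_grid_le[OF *, where \<alpha> = "2 * \<theta>" and \<beta> = \<theta> and \<gamma> = \<theta> and \<delta> = 0])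
          (auto simp: r algebra_simps)
    qed measurable
  qed
  consider "x < x'" "y < y'" | "x' < x" "y' < y" | "x < x'" "y' < y" | "x' < x" "y < y'"
    using ne by linarith
  then show ?thesis
  proof cases
    case 1 then show ?thesis using diag[of x x' y y'] pos by (simp add: min_def abs_if)
  next
    case 2 then show ?thesis using diag[of x' x y' y] pos by (simp add: min_def abs_if mult.commute)
  next
    case 3 then show ?thesis using anti[of x x' y' y] pos by (simp add: min_def abs_if mult.commute)
  next
    case 4 then show ?thesis using anti[of x' x y y'] pos by (simp add: min_def abs_if)
  qed
qed


section \<open>Bilinear forms with an exponentially decaying kernel\<close>

lemma nn_integral_exp_atLeast:
  fixes k s :: real
  assumes "0 < k"
  shows "(\<integral>\<^sup>+x. ennreal (exp (- k * (x - s))) * indicator {s..} x \<partial>lborel) = ennreal (1 / k)"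
proof -
  have "((\<lambda>x. - exp (- k * (x - s)) / k) \<longlongrightarrow> 0) at_top"
    using assms by real_asymp
  then have "(\<integral>\<^sup>+x. ennreal (exp (- k * (x - s))) * indicator {s..} x \<partial>lborel)
      = ennreal (0 - (- exp (- k * (s - s)) / k))"
    using assms by (intro nn_integral_FTC_atLeast) (auto intro!: derivative_eq_intros)
  then show ?thesis by simp
qed

lemma nn_integral_exp_atMost:
  fixes k s :: real
  assumes "0 < k"
  shows "(\<integral>\<^sup>+x. ennreal (exp (- k * (s - x))) * indicator {..s} x \<partial>lborel) = ennreal (1 / k)"
proof -
  have "(\<integral>\<^sup>+x. ennreal (exp (- k * (s - x))) * indicator {..s} x \<partial>lborel)
     = (\<integral>\<^sup>+x. ennreal (exp (- k * (s - (0 + (-1) * x)))) * indicator {..s} (0 + (-1) * x) \<partial>lborel)"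
    by (subst nn_integral_real_affine[where c = "-1" and t = 0]) auto
  also have "\<dots> = (\<integral>\<^sup>+x. ennreal (exp (- k * (x - (- s)))) * indicator {- s..} x \<partial>lborel)"
    by (intro nn_integral_cong) (auto simp: indicator_def algebra_simps)
  also have "\<dots> = ennreal (1 / k)"
    by (rule nn_integral_exp_atLeast[OF assms])
  finally show ?thesis .
qed

text \<open>For \<open>p < P\<close> and \<open>q < Q\<close> the exponent is, up to \<open>c\<close>, the total area of the two off-diagonal
  rectangles of the grid with corners \<open>(p, q)\<close> and \<open>(P, Q)\<close>. The indicators make \<open>p\<close>, \<open>q\<close>
  nonnegative and the smaller coordinates, so that integrals can range over the whole line.\<close>

definition decay :: "real \<Rightarrow> real \<Rightarrow> real \<Rightarrow> real \<Rightarrow> real \<Rightarrow> ennreal" where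
  "decay c p P q Q = ennreal (exp (- c * (q * (P - p) + p * (Q - q)))) * indicator {0..P} p * indicator {0..Q} q"

lemma measurable_decay[measurable (raw)]:
  assumes [measurable]: "p \<in> borel_measurable N" "P \<in> borel_measurable N"
    "q \<in> borel_measurable N" "Q \<in> borel_measurable N"
  shows "(\<lambda>x. decay c (p x) (P x) (q x) (Q x)) \<in> borel_measurable N"
proof -
  have "decay c p P q Q = ennreal (exp (- c * (q * (P - p) + p * (Q - q)))) *
     (if 0 \<le> p \<and> p \<le> P \<and> 0 \<le> q \<and> q \<le> Q then 1 else 0)" for p P q Q
    by (auto simp: decay_def)
  then show ?thesis by simp
qed

lemma nn_integral_product_split:
  fixes f g :: "real \<Rightarrow> ennreal"
  assumes [measurable]: "f \<in> borel_measurable borel" "g \<in> borel_measurable borel"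
  shows "(\<integral>\<^sup>+x. \<integral>\<^sup>+y. f x * g y \<partial>lborel \<partial>lborel) = (\<integral>\<^sup>+x. f x \<partial>lborel) * (\<integral>\<^sup>+y. g y \<partial>lborel)"
  by (simp add: nn_integral_cmult nn_integral_multc)

text \<open>With the lower left corner fixed, the exponential is a product of a function of \<open>P\<close> and a function
  of \<open>Q\<close>.\<close>

lemma decay_integral_upper:
  assumes "0 < c" "0 < p" "0 < q"
  shows "ennreal (p * q) * (\<integral>\<^sup>+P. \<integral>\<^sup>+Q. decay c p P q Q \<partial>lborel \<partial>lborel) = ennreal (1 / c\<^sup>2)"
proof -
  have "(\<integral>\<^sup>+P. \<integral>\<^sup>+Q. decay c p P q Q \<partial>lborel \<partial>lborel) =
     (\<integral>\<^sup>+P. \<integral>\<^sup>+Q. (ennreal (exp (- (c * q) * (P - p))) * indicator {p..} P) *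
        (ennreal (exp (- (c * p) * (Q - q))) * indicator {q..} Q) \<partial>lborel \<partial>lborel)"
    using assms by (intro nn_integral_cong)
      (auto simp: decay_def indicator_def ennreal_mult[symmetric] exp_add[symmetric] algebra_simps)
  also have "\<dots> = ennreal (1 / (c * q)) * ennreal (1 / (c * p))"
    using assms nn_integral_exp_atLeast[of "c * q" p] nn_integral_exp_atLeast[of "c * p" q]
    by (subst nn_integral_product_split) simp_all
  finally show ?thesis
    using assms by (simp add: ennreal_mult[symmetric] power2_eq_square field_simps)
qed

text \<open>With the upper right corner fixed, put \<open>s = p / P\<close> and \<open>t = q / Q\<close>: the exponent is a multiple of
  \<open>s (1 - t) + t (1 - s)\<close>, which vanishes only at \<open>(0, 0)\<close> and \<open>(1, 1)\<close>. In each of the two terms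
  on the right the exponent grows linearly away from one of these corners, and the exponent on the
  left dominates one or the other according to the side of the diagonal \<open>s + t = 1\<close> on which
  \<open>(s, t)\<close> lies. The factors \<open>p - 0\<close>, \<open>q - 0\<close> give all four exponentials the shape of the
  one-dimensional integrals.\<close>

lemma decay_le_corners:
  assumes "0 < c" "0 < P" "0 < Q"
  shows "decay c p P q Q \<le>
      (ennreal (exp (- (c * Q / 2) * (p - 0))) * indicator {0..} p) *
      (ennreal (exp (- (c * P / 2) * (q - 0))) * indicator {0..} q)
    + (ennreal (exp (- (c * Q / 2) * (P - p))) * indicator {..P} p) *
      (ennreal (exp (- (c * P / 2) * (Q - q))) * indicator {..Q} q)"
proof (cases "0 \<le> p \<and> p \<le> P \<and> 0 \<le> q \<and> q \<le> Q")
  case True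
  define e where "e = q * (P - p) + p * (Q - q)"
  \<comment> \<open>In scaled variables: \<open>s + t - 2 s t \<ge> (s + t) / 2\<close> if \<open>s + t \<le> 1\<close>. This follows
    from \<open>4 s t \<le> (s + t)\<^sup>2\<close>.\<close>
  have near: "(Q * s + P * t) / 2 \<le> t * (P - s) + s * (Q - t)"
    if "0 \<le> s" "0 \<le> t" "Q * s + P * t \<le> P * Q" for s t :: real
  proof -
    have "4 * (P * Q) * (s * t) \<le> (Q * s + P * t)\<^sup>2"
      using zero_le_power2[of "Q * s - P * t"] by (simp add: power2_eq_square algebra_simps)
    also have "\<dots> \<le> (P * Q) * (Q * s + P * t)"
      using that assms by (auto simp: power2_eq_square intro!: mult_right_mono)
    finally have "(P * Q) * (4 * (s * t)) \<le> (P * Q) * (Q * s + P * t)" by (simp add: mult_ac)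
    then have "4 * (s * t) \<le> Q * s + P * t"
      using assms by (simp add: mult_le_cancel_left)
    then show ?thesis by (simp add: field_simps)
  qed
  have "exp (- c * e) \<le> exp (- c * ((Q * p + P * q) / 2)) + exp (- c * ((Q * (P - p) + P * (Q - q)) / 2))"
  proof (cases "Q * p + P * q \<le> P * Q")
    case le: True
    have "exp (- c * e) \<le> exp (- c * ((Q * p + P * q) / 2))"
      using near[of p q] True le assms by (simp add: e_def)
    then show ?thesis by (simp add: add_increasing2)
  next
    \<comment> \<open>The exponent is invariant under reflection at the centre of the rectangle.\<close>
    case gt: False
    then have "Q * (P - p) + P * (Q - q) \<le> P * Q" by (simp add: algebra_simps)
    then have "(Q * (P - p) + P * (Q - q)) / 2 \<le> e"
      using near[of "P - p" "Q - q"] True by (simp add: e_def algebra_simps)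
    then have "exp (- c * e) \<le> exp (- c * ((Q * (P - p) + P * (Q - q)) / 2))"
      using assms by simp
    then show ?thesis by (simp add: add_increasing)
  qed
  then have "ennreal (exp (- c * e)) \<le> ennreal (exp (- c * ((Q * p + P * q) / 2)))
      + ennreal (exp (- c * ((Q * (P - p) + P * (Q - q)) / 2)))"
    by (simp flip: ennreal_plus)
  with True show ?thesis
    by (simp add: decay_def e_def ennreal_mult[symmetric] exp_add[symmetric] algebra_simps add_divide_distrib diff_divide_distrib)
qed (auto simp: decay_def)

lemma decay_integral_lower:
  assumes "0 < c" "0 < P" "0 < Q"
  shows "ennreal (P * Q) * (\<integral>\<^sup>+p. \<integral>\<^sup>+q. decay c p P q Q \<partial>lborel \<partial>lborel) \<le> ennreal (8 / c\<^sup>2)"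
proof -
  let ?f = "\<lambda>p. ennreal (exp (- (c * Q / 2) * (p - 0))) * indicator {0..} p"
  let ?g = "\<lambda>q. ennreal (exp (- (c * P / 2) * (q - 0))) * indicator {0..} q"
  let ?f' = "\<lambda>p. ennreal (exp (- (c * Q / 2) * (P - p))) * indicator {..P} p"
  let ?g' = "\<lambda>q. ennreal (exp (- (c * P / 2) * (Q - q))) * indicator {..Q} q"
  have "(\<integral>\<^sup>+p. \<integral>\<^sup>+q. decay c p P q Q \<partial>lborel \<partial>lborel) \<le>
     (\<integral>\<^sup>+p. \<integral>\<^sup>+q. ?f p * ?g q + ?f' p * ?g' q \<partial>lborel \<partial>lborel)"
    by (intro nn_integral_mono decay_le_corners assms)
  also have "\<dots> = (\<integral>\<^sup>+p. \<integral>\<^sup>+q. ?f p * ?g q \<partial>lborel \<partial>lborel) + (\<integral>\<^sup>+p. \<integral>\<^sup>+q. ?f' p * ?g' q \<partial>lborel \<partial>lborel)"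
    by (simp add: nn_integral_add)
  also have "\<dots> = ennreal (1 / (c * Q / 2)) * ennreal (1 / (c * P / 2))
     + ennreal (1 / (c * Q / 2)) * ennreal (1 / (c * P / 2))"
    using assms nn_integral_exp_atLeast[of "c * Q / 2" 0] nn_integral_exp_atLeast[of "c * P / 2" 0]
      nn_integral_exp_atMost[of "c * Q / 2" P] nn_integral_exp_atMost[of "c * P / 2" Q]
    by (subst (1 2) nn_integral_product_split) simp_all
  also have "\<dots> = ennreal (8 / (c\<^sup>2 * (P * Q)))"
    using assms by (simp add: ennreal_mult[symmetric] ennreal_plus[symmetric] power2_eq_square field_simps del: ennreal_plus)
  finally have "ennreal (P * Q) * (\<integral>\<^sup>+p. \<integral>\<^sup>+q. decay c p P q Q \<partial>lborel \<partial>lborel) \<le>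
     ennreal (P * Q) * ennreal (8 / (c\<^sup>2 * (P * Q)))"
    by (rule mult_left_mono) simp
  also have "\<dots> = ennreal (8 / c\<^sup>2)"
    using assms by (simp add: ennreal_mult[symmetric])
  finally show ?thesis .
qed

lemma nn_integral_swap:
  fixes h :: "real \<Rightarrow> real \<Rightarrow> ennreal"
  assumes "case_prod h \<in> borel_measurable (borel \<Otimes>\<^sub>M borel)"
  shows "(\<integral>\<^sup>+x. \<integral>\<^sup>+y. h x y \<partial>lborel \<partial>lborel) = (\<integral>\<^sup>+y. \<integral>\<^sup>+x. h x y \<partial>lborel \<partial>lborel)"
  by (rule lborel_pair.Fubini'[symmetric]) (use assms in simp)

text \<open>The integrand is one of \<open>h x y\<close> and \<open>h y x\<close>.\<close>

lemma nn_integral_min_max_le: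
  fixes h :: "real \<Rightarrow> real \<Rightarrow> ennreal"
  assumes [measurable]: "case_prod h \<in> borel_measurable (borel \<Otimes>\<^sub>M borel)"
  shows "(\<integral>\<^sup>+x. \<integral>\<^sup>+y. h (min x y) (max x y) \<partial>lborel \<partial>lborel) \<le> 2 * (\<integral>\<^sup>+x. \<integral>\<^sup>+y. h x y \<partial>lborel \<partial>lborel)"
proof -
  have "(\<integral>\<^sup>+x. \<integral>\<^sup>+y. h (min x y) (max x y) \<partial>lborel \<partial>lborel) \<le> (\<integral>\<^sup>+x. \<integral>\<^sup>+y. h x y + h y x \<partial>lborel \<partial>lborel)"
    by (intro nn_integral_mono) (auto simp: min_def max_def)
  also have "\<dots> = (\<integral>\<^sup>+x. \<integral>\<^sup>+y. h x y \<partial>lborel \<partial>lborel) + (\<integral>\<^sup>+x. \<integral>\<^sup>+y. h y x \<partial>lborel \<partial>lborel)"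
    by (simp add: nn_integral_add)
  also have "(\<integral>\<^sup>+x. \<integral>\<^sup>+y. h y x \<partial>lborel \<partial>lborel) = (\<integral>\<^sup>+x. \<integral>\<^sup>+y. h x y \<partial>lborel \<partial>lborel)"
    by (rule nn_integral_swap) measurable
  finally show ?thesis by (simp add: mult_2)
qed

text \<open>Each of the two weights depends on one corner only. Integrating the decay over the other corner
  leaves \<open>1 / c\<^sup>2\<close> for the lower left and at most \<open>8 / c\<^sup>2\<close> for the upper right corner.\<close>

lemma ordered_form_le:
  fixes u v :: "real \<Rightarrow> ennreal"
  assumes "0 < c" and [measurable]: "u \<in> borel_measurable borel" "v \<in> borel_measurable borel"
    and supp: "\<And>x. x \<le> 0 \<Longrightarrow> u x = 0" "\<And>y. y \<le> 0 \<Longrightarrow> v y = 0"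
  shows "(\<integral>\<^sup>+p. \<integral>\<^sup>+P. \<integral>\<^sup>+q. \<integral>\<^sup>+Q. (u p * v q * ennreal (p * q) + u P * v Q * ennreal (P * Q)) * decay c p P q Q
            \<partial>lborel \<partial>lborel \<partial>lborel \<partial>lborel)
    \<le> ennreal (9 / c\<^sup>2) * ((\<integral>\<^sup>+x. u x \<partial>lborel) * (\<integral>\<^sup>+y. v y \<partial>lborel))"
proof -
  let ?w = "\<lambda>x y. u x * v y * ennreal (x * y)"
  let ?I = "(\<integral>\<^sup>+x. u x \<partial>lborel) * (\<integral>\<^sup>+y. v y \<partial>lborel)"
  have lower: "(\<integral>\<^sup>+p. \<integral>\<^sup>+P. \<integral>\<^sup>+q. \<integral>\<^sup>+Q. ?w p q * decay c p P q Q \<partial>lborel \<partial>lborel \<partial>lborel \<partial>lborel)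
     \<le> ennreal (1 / c\<^sup>2) * ?I"
  proof -
    have "(\<integral>\<^sup>+p. \<integral>\<^sup>+P. \<integral>\<^sup>+q. \<integral>\<^sup>+Q. ?w p q * decay c p P q Q \<partial>lborel \<partial>lborel \<partial>lborel \<partial>lborel)
      = (\<integral>\<^sup>+p. \<integral>\<^sup>+q. \<integral>\<^sup>+P. \<integral>\<^sup>+Q. ?w p q * decay c p P q Q \<partial>lborel \<partial>lborel \<partial>lborel \<partial>lborel)"
      by (intro nn_integral_cong nn_integral_swap) measurable
    also have "\<dots> = (\<integral>\<^sup>+p. \<integral>\<^sup>+q. u p * v q * (ennreal (p * q) *
        (\<integral>\<^sup>+P. \<integral>\<^sup>+Q. decay c p P q Q \<partial>lborel \<partial>lborel)) \<partial>lborel \<partial>lborel)"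
      by (simp add: nn_integral_cmult mult.assoc)
    also have "\<dots> \<le> (\<integral>\<^sup>+p. \<integral>\<^sup>+q. u p * v q * ennreal (1 / c\<^sup>2) \<partial>lborel \<partial>lborel)"
    proof (intro nn_integral_mono)
      fix p q show "u p * v q * (ennreal (p * q) * (\<integral>\<^sup>+P. \<integral>\<^sup>+Q. decay c p P q Q \<partial>lborel \<partial>lborel))
        \<le> u p * v q * ennreal (1 / c\<^sup>2)"
        using supp[of p] supp[of q] decay_integral_upper[of c p q] assms(1)
        by (cases "0 < p \<and> 0 < q") (auto simp: not_less)
    qed
    also have "\<dots> = ennreal (1 / c\<^sup>2) * ?I"
      by (simp add: nn_integral_multc nn_integral_cmult mult.commute)
    finally show ?thesis .
  qed
  have upper: "(\<integral>\<^sup>+p. \<integral>\<^sup>+P. \<integral>\<^sup>+q. \<integral>\<^sup>+Q. ?w P Q * decay c p P q Q \<partial>lborel \<partial>lborel \<partial>lborel \<partial>lborel)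
     \<le> ennreal (8 / c\<^sup>2) * ?I"
  proof -
    have "(\<integral>\<^sup>+p. \<integral>\<^sup>+P. \<integral>\<^sup>+q. \<integral>\<^sup>+Q. ?w P Q * decay c p P q Q \<partial>lborel \<partial>lborel \<partial>lborel \<partial>lborel)
      = (\<integral>\<^sup>+P. \<integral>\<^sup>+p. \<integral>\<^sup>+q. \<integral>\<^sup>+Q. ?w P Q * decay c p P q Q \<partial>lborel \<partial>lborel \<partial>lborel \<partial>lborel)"
      by (rule nn_integral_swap) measurable
    also have "\<dots> = (\<integral>\<^sup>+P. \<integral>\<^sup>+p. \<integral>\<^sup>+Q. \<integral>\<^sup>+q. ?w P Q * decay c p P q Q \<partial>lborel \<partial>lborel \<partial>lborel \<partial>lborel)"
      by (intro nn_integral_cong nn_integral_swap) measurable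
    also have "\<dots> = (\<integral>\<^sup>+P. \<integral>\<^sup>+Q. \<integral>\<^sup>+p. \<integral>\<^sup>+q. ?w P Q * decay c p P q Q \<partial>lborel \<partial>lborel \<partial>lborel \<partial>lborel)"
      by (intro nn_integral_cong nn_integral_swap) measurable
    also have "\<dots> = (\<integral>\<^sup>+P. \<integral>\<^sup>+Q. u P * v Q * (ennreal (P * Q) *
        (\<integral>\<^sup>+p. \<integral>\<^sup>+q. decay c p P q Q \<partial>lborel \<partial>lborel)) \<partial>lborel \<partial>lborel)"
      by (simp add: nn_integral_cmult mult.assoc)
    also have "\<dots> \<le> (\<integral>\<^sup>+P. \<integral>\<^sup>+Q. u P * v Q * ennreal (8 / c\<^sup>2) \<partial>lborel \<partial>lborel)"
    proof (intro nn_integral_mono)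
      fix P Q show "u P * v Q * (ennreal (P * Q) * (\<integral>\<^sup>+p. \<integral>\<^sup>+q. decay c p P q Q \<partial>lborel \<partial>lborel))
        \<le> u P * v Q * ennreal (8 / c\<^sup>2)"
        using supp[of P] supp[of Q] decay_integral_lower[of c P Q] assms(1)
        by (cases "0 < P \<and> 0 < Q") (auto simp: not_less intro: mult_left_mono)
    qed
    also have "\<dots> = ennreal (8 / c\<^sup>2) * ?I"
      by (simp add: nn_integral_multc nn_integral_cmult mult.commute)
    finally show ?thesis .
  qed
  have "(\<integral>\<^sup>+p. \<integral>\<^sup>+P. \<integral>\<^sup>+q. \<integral>\<^sup>+Q. (?w p q + ?w P Q) * decay c p P q Q \<partial>lborel \<partial>lborel \<partial>lborel \<partial>lborel)
    = (\<integral>\<^sup>+p. \<integral>\<^sup>+P. \<integral>\<^sup>+q. \<integral>\<^sup>+Q. ?w p q * decay c p P q Q \<partial>lborel \<partial>lborel \<partial>lborel \<partial>lborel)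
    + (\<integral>\<^sup>+p. \<integral>\<^sup>+P. \<integral>\<^sup>+q. \<integral>\<^sup>+Q. ?w P Q * decay c p P q Q \<partial>lborel \<partial>lborel \<partial>lborel \<partial>lborel)"
    by (simp add: distrib_right nn_integral_add)
  also have "\<dots> \<le> ennreal (1 / c\<^sup>2) * ?I + ennreal (8 / c\<^sup>2) * ?I"
    by (intro add_mono lower upper)
  also have "\<dots> = ennreal (9 / c\<^sup>2) * ?I"
    by (simp add: distrib_right[symmetric] ennreal_plus[symmetric] add_divide_distrib[symmetric] del: ennreal_plus)
  finally show ?thesis .
qed

text \<open>The bound is special to tensor products \<open>F x * G y\<close>: for general functions on the quadrant it
  fails, because the kernel, with the square roots included, does not decay when the second point
  moves off along a hyperbola \<open>x' * y' = const\<close>. The tensor form allows the four factors to be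
  regrouped as values at the lower left corner \<open>(p, q)\<close> and at the upper right corner \<open>(P, Q)\<close> of
  the rectangle spanned by the two points, whatever their relative position. After
  \<open>\<bar>s t\<bar> \<le> s\<^sup>2 + t\<^sup>2\<close> each term sees only one corner. Ordering both pairs of coordinates costs a
  factor 4.\<close>

lemma kernel_form_le:
  fixes F G :: "real \<Rightarrow> real"
  assumes "0 < c" and [measurable]: "F \<in> borel_measurable borel" "G \<in> borel_measurable borel"
    and supp: "\<And>x. x \<le> 0 \<Longrightarrow> F x = 0" "\<And>y. y \<le> 0 \<Longrightarrow> G y = 0"
  shows "(\<integral>\<^sup>+(x, y). \<integral>\<^sup>+(x', y'). ennreal (\<bar>(F x * G y * sqrt (x * y)) * (F x' * G y' * sqrt (x' * y'))\<bar> *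
            exp (- c * (min y y' * \<bar>x - x'\<bar> + min x x' * \<bar>y - y'\<bar>))) \<partial>lborel \<partial>lborel)
    \<le> ennreal (36 / c\<^sup>2) * ((\<integral>\<^sup>+x. ennreal ((F x)\<^sup>2) \<partial>lborel) * (\<integral>\<^sup>+y. ennreal ((G y)\<^sup>2) \<partial>lborel))"
proof -
  let ?k = "\<lambda>x y x' y'. ennreal (\<bar>(F x * G y * sqrt (x * y)) * (F x' * G y' * sqrt (x' * y'))\<bar> *
            exp (- c * (min y y' * \<bar>x - x'\<bar> + min x x' * \<bar>y - y'\<bar>)))"
  define J where "J = (\<lambda>p P q Q. (ennreal ((F p)\<^sup>2) * ennreal ((G q)\<^sup>2) * ennreal (p * q)
     + ennreal ((F P)\<^sup>2) * ennreal ((G Q)\<^sup>2) * ennreal (P * Q)) * decay c p P q Q)"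
  have [measurable]: "(\<lambda>x. J (p x) (P x) (q x) (Q x)) \<in> borel_measurable N"
    if [measurable]: "p \<in> borel_measurable N" "P \<in> borel_measurable N"
      "q \<in> borel_measurable N" "Q \<in> borel_measurable N" for p P q Q and N :: "'z measure"
    unfolding J_def by measurable
  have pointwise: "?k x y x' y' \<le> J (min x x') (max x x') (min y y') (max y y')" for x y x' y'
  proof (cases "0 < x \<and> 0 < y \<and> 0 < x' \<and> 0 < y'")
    case True
    let ?p = "min x x'" and ?P = "max x x'" and ?q = "min y y'" and ?Q = "max y y'"
    define s where "s = F ?p * G ?q * sqrt (?p * ?q)"
    define t where "t = F ?P * G ?Q * sqrt (?P * ?Q)"
    have "\<bar>(F x * G y * sqrt (x * y)) * (F x' * G y' * sqrt (x' * y'))\<bar> = \<bar>s * t\<bar>"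
      by (auto simp: s_def t_def min_def max_def abs_mult real_sqrt_mult mult_ac)
    also have "\<dots> \<le> 2 * \<bar>s\<bar> * \<bar>t\<bar>"
      by (simp add: abs_mult)
    also have "\<dots> \<le> s\<^sup>2 + t\<^sup>2"
      using sum_squares_bound[of "\<bar>s\<bar>" "\<bar>t\<bar>"] by simp
    also have "\<dots> = (F ?p)\<^sup>2 * (G ?q)\<^sup>2 * (?p * ?q) + (F ?P)\<^sup>2 * (G ?Q)\<^sup>2 * (?P * ?Q)"
      using True by (simp add: s_def t_def power_mult_distrib less_max_iff_disj less_imp_le)
    finally have *: "\<bar>(F x * G y * sqrt (x * y)) * (F x' * G y' * sqrt (x' * y'))\<bar> \<le> \<dots>" .
    have "min y y' * \<bar>x - x'\<bar> + min x x' * \<bar>y - y'\<bar> = ?q * (?P - ?p) + ?p * (?Q - ?q)"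
      by (auto simp: min_def max_def)
    moreover have "decay c ?p ?P ?q ?Q = ennreal (exp (- c * (?q * (?P - ?p) + ?p * (?Q - ?q))))"
      using True by (simp add: decay_def)
    ultimately have "?k x y x' y' = ennreal \<bar>(F x * G y * sqrt (x * y)) * (F x' * G y' * sqrt (x' * y'))\<bar>
        * decay c ?p ?P ?q ?Q"
      by (simp only: ennreal_mult abs_ge_zero exp_ge_zero)
    also have "\<dots> \<le> ennreal ((F ?p)\<^sup>2 * (G ?q)\<^sup>2 * (?p * ?q) + (F ?P)\<^sup>2 * (G ?Q)\<^sup>2 * (?P * ?Q))
        * decay c ?p ?P ?q ?Q"
      by (intro mult_right_mono ennreal_leI *) simp
    also have "ennreal ((F ?p)\<^sup>2 * (G ?q)\<^sup>2 * (?p * ?q) + (F ?P)\<^sup>2 * (G ?Q)\<^sup>2 * (?P * ?Q)) =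
        ennreal ((F ?p)\<^sup>2) * ennreal ((G ?q)\<^sup>2) * ennreal (?p * ?q)
        + ennreal ((F ?P)\<^sup>2) * ennreal ((G ?Q)\<^sup>2) * ennreal (?P * ?Q)"
    proof -
      have "0 \<le> ?p * ?q" "0 \<le> ?P * ?Q"
        using True by (auto intro!: mult_nonneg_nonneg simp: le_max_iff_disj)
      then show ?thesis
        by (simp only: ennreal_plus ennreal_mult mult_nonneg_nonneg zero_le_power2)
    qed
    also have "\<dots> * decay c ?p ?P ?q ?Q = J ?p ?P ?q ?Q"
      by (simp only: J_def)
    finally show ?thesis .
  next
    case False
    then show ?thesis using supp by (auto simp: not_less)
  qed
  have "(\<integral>\<^sup>+(x, y). \<integral>\<^sup>+(x', y'). ?k x y x' y' \<partial>lborel \<partial>lborel) \<le>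
    (\<integral>\<^sup>+(x, y). \<integral>\<^sup>+(x', y'). J (min x x') (max x x') (min y y') (max y y') \<partial>lborel \<partial>lborel)"
    unfolding case_prod_beta by (intro nn_integral_mono pointwise)
  also have "\<dots> = (\<integral>\<^sup>+x. \<integral>\<^sup>+y. \<integral>\<^sup>+x'. \<integral>\<^sup>+y'. J (min x x') (max x x') (min y y') (max y y')
      \<partial>lborel \<partial>lborel \<partial>lborel \<partial>lborel)"
    by (simp add: lborel_prod[symmetric] lborel.nn_integral_fst[symmetric] del: lborel_prod)
  also have "\<dots> = (\<integral>\<^sup>+x. \<integral>\<^sup>+x'. \<integral>\<^sup>+y. \<integral>\<^sup>+y'. J (min x x') (max x x') (min y y') (max y y')
      \<partial>lborel \<partial>lborel \<partial>lborel \<partial>lborel)"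
    by (intro nn_integral_cong nn_integral_swap) measurable
  also have "\<dots> \<le> (\<integral>\<^sup>+x. \<integral>\<^sup>+x'. 2 * (\<integral>\<^sup>+q. \<integral>\<^sup>+Q. J (min x x') (max x x') q Q
      \<partial>lborel \<partial>lborel) \<partial>lborel \<partial>lborel)"
    by (intro nn_integral_mono nn_integral_min_max_le) measurable
  also have "\<dots> \<le> 2 * (\<integral>\<^sup>+p. \<integral>\<^sup>+P. 2 * (\<integral>\<^sup>+q. \<integral>\<^sup>+Q. J p P q Q \<partial>lborel \<partial>lborel) \<partial>lborel \<partial>lborel)"
    by (rule nn_integral_min_max_le) measurable
  also have "\<dots> = 4 * (\<integral>\<^sup>+p. \<integral>\<^sup>+P. \<integral>\<^sup>+q. \<integral>\<^sup>+Q. J p P q Q \<partial>lborel \<partial>lborel \<partial>lborel \<partial>lborel)"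
    by (simp add: nn_integral_cmult mult.assoc[symmetric])
  also have "\<dots> \<le> 4 * (ennreal (9 / c\<^sup>2) *
      ((\<integral>\<^sup>+x. ennreal ((F x)\<^sup>2) \<partial>lborel) * (\<integral>\<^sup>+y. ennreal ((G y)\<^sup>2) \<partial>lborel)))"
    unfolding J_def using supp assms(1)
    by (intro mult_left_mono ordered_form_le) auto
  also have "\<dots> = ennreal (36 / c\<^sup>2) *
      ((\<integral>\<^sup>+x. ennreal ((F x)\<^sup>2) \<partial>lborel) * (\<integral>\<^sup>+y. ennreal ((G y)\<^sup>2) \<partial>lborel))"
    by (simp add: mult.assoc[symmetric] ennreal_mult[symmetric] flip: ennreal_numeral)
  finally show ?thesis .
qed


section \<open>Second moments of integrals of random fields\<close>

lemma abs_integral_le_nn_integral: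
  fixes f :: "'b \<Rightarrow> real"
  shows "ennreal \<bar>\<integral>x. f x \<partial>N\<bar> \<le> (\<integral>\<^sup>+x. ennreal \<bar>f x\<bar> \<partial>N)"
  using integral_norm_bound_ennreal[of N f]
  by (cases "integrable N f") (auto simp: not_integrable_integral_eq)

text \<open>The absolute value stays outside the inner expectation, so that cancellation in the correlations
  of \<open>X\<close> is retained. Fubini's theorem is therefore needed for the signed integrand; it applies
  because \<open>h\<close> is integrable and \<open>X\<close> bounded.\<close>

lemma (in prob_space) second_moment_of_integral_le:
  fixes X :: "'b \<Rightarrow> 'a \<Rightarrow> real" and h :: "'b \<Rightarrow> real"
  assumes "sigma_finite_measure N"
    and X[measurable]: "case_prod X \<in> borel_measurable (N \<Otimes>\<^sub>M M)"
    and bounded: "\<And>p \<omega>. \<bar>X p \<omega>\<bar> \<le> 1"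
    and h: "integrable N h"
  shows "ennreal (expectation (\<lambda>\<omega>. (\<integral>p. h p * X p \<omega> \<partial>N)\<^sup>2))
    \<le> (\<integral>\<^sup>+p. \<integral>\<^sup>+p'. ennreal (\<bar>h p * h p'\<bar> * \<bar>expectation (\<lambda>\<omega>. X p \<omega> * X p' \<omega>)\<bar>) \<partial>N \<partial>N)"
proof -
  interpret N: sigma_finite_measure N by fact
  interpret pair_sigma_finite M N ..
  have [measurable]: "h \<in> borel_measurable N" using h by auto
  let ?Z = "\<lambda>\<omega>. \<integral>p. h p * X p \<omega> \<partial>N"
  let ?H = "\<integral>p. \<bar>h p\<bar> \<partial>N"
  have swap: "expectation (\<lambda>\<omega>. \<integral>p. h p * Y p \<omega> \<partial>N) = (\<integral>p. h p * expectation (Y p) \<partial>N)"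
    if [measurable]: "case_prod Y \<in> borel_measurable (N \<Otimes>\<^sub>M M)" and Y: "\<And>p \<omega>. \<bar>Y p \<omega>\<bar> \<le> C"
    for Y C
  proof -
    have "integrable (M \<Otimes>\<^sub>M N) (\<lambda>(\<omega>, p). C * h p)"
      using h by (intro Fubini_integrable) auto
    then have "integrable (M \<Otimes>\<^sub>M N) (\<lambda>(\<omega>, p). h p * Y p \<omega>)"
    proof (rule Bochner_Integration.integrable_bound)
      show "AE x in M \<Otimes>\<^sub>M N. norm (case x of (\<omega>, p) \<Rightarrow> h p * Y p \<omega>) \<le> norm (case x of (\<omega>, p) \<Rightarrow> C * h p)"
      proof (intro AE_I2, clarsimp simp: abs_mult)
        fix \<omega> p show "\<bar>h p\<bar> * \<bar>Y p \<omega>\<bar> \<le> \<bar>C\<bar> * \<bar>h p\<bar>"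
          using mult_left_mono[of "\<bar>Y p \<omega>\<bar>" "\<bar>C\<bar>" "\<bar>h p\<bar>"] Y[of p \<omega>] by (simp add: mult.commute)
      qed
    qed measurable
    from Fubini_integral[OF this] show ?thesis by simp
  qed
  have Z[measurable]: "?Z \<in> borel_measurable M" by measurable
  have Z_le: "\<bar>?Z \<omega>\<bar> \<le> ?H" for \<omega>
  proof (cases "integrable N (\<lambda>p. h p * X p \<omega>)")
    case True
    have "\<bar>?Z \<omega>\<bar> \<le> (\<integral>p. \<bar>h p * X p \<omega>\<bar> \<partial>N)" by (rule integral_abs_bound)
    also have "\<dots> \<le> ?H"
      using integrable_abs[OF True] integrable_abs[OF h] bounded
      by (intro integral_mono) (auto simp: abs_mult mult_left_le)
    finally show ?thesis .
  next
    case False then show ?thesis by (simp add: not_integrable_integral_eq)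
  qed
  have "\<bar>X p \<omega> * ?Z \<omega>\<bar> \<le> ?H" for p \<omega>
    using mult_mono[OF bounded Z_le] by (simp add: abs_mult)
  then have "expectation (\<lambda>\<omega>. (?Z \<omega>)\<^sup>2) = (\<integral>p. h p * expectation (\<lambda>\<omega>. X p \<omega> * ?Z \<omega>) \<partial>N)"
    by (subst swap[symmetric])
      (auto simp: power2_eq_square mult.assoc[symmetric] simp flip: integral_mult_left_zero)
  also have "\<dots> = (\<integral>p. h p * (\<integral>p'. h p' * expectation (\<lambda>\<omega>. X p \<omega> * X p' \<omega>) \<partial>N) \<partial>N)"
  proof (intro Bochner_Integration.integral_cong refl arg_cong[where f = "(*) (h _)"])
    fix p assume [measurable]: "p \<in> space N"
    have "expectation (\<lambda>\<omega>. X p \<omega> * ?Z \<omega>) = expectation (\<lambda>\<omega>. \<integral>p'. h p' * (X p \<omega> * X p' \<omega>) \<partial>N)"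
      by (simp add: mult.left_commute flip: integral_mult_right_zero)
    also have "\<dots> = (\<integral>p'. h p' * expectation (\<lambda>\<omega>. X p \<omega> * X p' \<omega>) \<partial>N)"
    proof (rule swap)
      show "\<bar>X p \<omega> * X p' \<omega>\<bar> \<le> 1" for p' \<omega>
        using mult_mono[OF bounded bounded, of p \<omega> p' \<omega>] by (simp add: abs_mult mult.commute)
    qed measurable
    finally show "expectation (\<lambda>\<omega>. X p \<omega> * ?Z \<omega>)
      = (\<integral>p'. h p' * expectation (\<lambda>\<omega>. X p \<omega> * X p' \<omega>) \<partial>N)" .
  qed
  finally have E: "expectation (\<lambda>\<omega>. (?Z \<omega>)\<^sup>2)
      = (\<integral>p. h p * (\<integral>p'. h p' * expectation (\<lambda>\<omega>. X p \<omega> * X p' \<omega>) \<partial>N) \<partial>N)" .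
  have "ennreal (expectation (\<lambda>\<omega>. (?Z \<omega>)\<^sup>2)) \<le>
     ennreal \<bar>\<integral>p. h p * (\<integral>p'. h p' * expectation (\<lambda>\<omega>. X p \<omega> * X p' \<omega>) \<partial>N) \<partial>N\<bar>"
    unfolding E by (intro ennreal_leI) simp
  also have "\<dots> \<le> (\<integral>\<^sup>+p. ennreal \<bar>h p * (\<integral>p'. h p' * expectation (\<lambda>\<omega>. X p \<omega> * X p' \<omega>) \<partial>N)\<bar> \<partial>N)"
    by (rule abs_integral_le_nn_integral)
  also have "\<dots> \<le> (\<integral>\<^sup>+p. \<integral>\<^sup>+p'. ennreal (\<bar>h p * h p'\<bar> * \<bar>expectation (\<lambda>\<omega>. X p \<omega> * X p' \<omega>)\<bar>) \<partial>N \<partial>N)"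
  proof (intro nn_integral_mono)
    fix p
    have "ennreal \<bar>h p * (\<integral>p'. h p' * expectation (\<lambda>\<omega>. X p \<omega> * X p' \<omega>) \<partial>N)\<bar>
      = ennreal \<bar>\<integral>p'. h p * (h p' * expectation (\<lambda>\<omega>. X p \<omega> * X p' \<omega>)) \<partial>N\<bar>" by simp
    also have "\<dots> \<le> (\<integral>\<^sup>+p'. ennreal \<bar>h p * (h p' * expectation (\<lambda>\<omega>. X p \<omega> * X p' \<omega>))\<bar> \<partial>N)"
      by (rule abs_integral_le_nn_integral)
    finally show "ennreal \<bar>h p * (\<integral>p'. h p' * expectation (\<lambda>\<omega>. X p \<omega> * X p' \<omega>) \<partial>N)\<bar>
      \<le> (\<integral>\<^sup>+p'. ennreal (\<bar>h p * h p'\<bar> * \<bar>expectation (\<lambda>\<omega>. X p \<omega> * X p' \<omega>)\<bar>) \<partial>N)"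
      by (simp add: abs_mult mult.assoc)
  qed
  finally show ?thesis .
qed


section \<open>Borel versions and tensor products\<close>

lemma AE_lborel_pair:
  fixes S T :: "real \<Rightarrow> bool"
  assumes "AE x in lborel. S x" "AE y in lborel. T y"
  shows "AE p in (lborel :: (real \<times> real) measure). S (fst p) \<and> T (snd p)"
proof -
  obtain N N' where N: "N \<in> null_sets lborel" "{x. \<not> S x} \<subseteq> N"
    and N': "N' \<in> null_sets lborel" "{y. \<not> T y} \<subseteq> N'"
    using assms by (auto simp: eventually_ae_filter)
  have "N \<times> UNIV \<union> UNIV \<times> N' \<in> null_sets (lborel \<Otimes>\<^sub>M lborel :: (real \<times> real) measure)"
    using N(1) N'(1)
    by (intro null_sets.Un lborel.times_in_null_sets1 lborel.times_in_null_sets2) auto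
  moreover have "{p. \<not> (S (fst p) \<and> T (snd p))} \<subseteq> N \<times> UNIV \<union> UNIV \<times> N'"
    using N(2) N'(2) by auto
  ultimately show ?thesis
    unfolding lborel_prod by (intro AE_I'[of "N \<times> UNIV \<union> UNIV \<times> N'"]) auto
qed

lemma integral_lebesgue_eq_lborel:
  fixes f g :: "'b::euclidean_space \<Rightarrow> real"
  assumes g: "g \<in> borel_measurable borel" and eq: "AE x in lborel. g x = f x"
  shows "integral\<^sup>L lebesgue f = integral\<^sup>L lborel g"
proof -
  have g': "g \<in> borel_measurable lebesgue"
    using g by (simp add: measurable_completion)
  have ae: "AE x in lebesgue. g x = f x"
    using eq by (rule AE_completion)
  have "integral\<^sup>L lebesgue f = integral\<^sup>L lebesgue g"
    using borel_measurable_AE[OF g' ae] g' ae by (intro integral_cong_AE) auto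
  also have "\<dots> = integral\<^sup>L lborel g"
    using g by (intro integral_completion) simp
  finally show ?thesis .
qed

text \<open>A Borel version makes product measurability available. It is made to vanish also at \<open>0\<close>, so that
  only points off the axes matter.\<close>

lemma square_integrable_01_borel_version:
  assumes "square_integrable_01 f"
  obtains F where "F \<in> borel_measurable borel" "\<And>x. x \<notin> {0<..1} \<Longrightarrow> F x = 0"
    "AE x in lborel. F x = indicator {0..1} x * f x"
    "integrable lborel F" "integrable lborel (\<lambda>x. (F x)\<^sup>2)"
proof -
  have "f \<in> borel_measurable (lebesgue_on {0..1})"
    and sq: "integrable (lebesgue_on {0..1}) (\<lambda>x. (f x)\<^sup>2)"
    using assms by (auto simp: square_integrable_01_def)
  then have "(\<lambda>x. indicator {0..1} x * f x) \<in> borel_measurable lebesgue"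
    by (simp add: borel_measurable_restrict_space_iff)
  then obtain f' where f'[measurable]: "f' \<in> borel_measurable borel"
    and ae: "AE x in lborel. indicator {0..1} x * f x = f' x"
    using completion_ex_borel_measurable_real[of "\<lambda>x. indicator {0..1} x * f x" lborel] by auto
  define F where "F = (\<lambda>x. indicator {0<..1} x * f' x)"
  have F[measurable]: "F \<in> borel_measurable borel" by (simp add: F_def)
  have F0: "F x = 0" if "x \<notin> {0<..1}" for x using that by (simp add: F_def)
  have F_ae: "AE x in lborel. F x = indicator {0..1} x * f x"
    using ae AE_lborel_singleton[of 0]
  proof eventually_elim
    case (elim x)
    then show ?case by (cases "x \<in> {0..1}") (auto simp: F_def indicator_def)
  qed
  have "integrable lebesgue (\<lambda>x. indicator {0..1} x *\<^sub>R (f x)\<^sup>2)"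
    using sq by (subst (asm) integrable_restrict_space) auto
  moreover have "(\<lambda>x. (F x)\<^sup>2) \<in> borel_measurable lebesgue"
    by (intro measurable_completion) simp
  moreover have "AE x in lebesgue. indicator {0..1} x *\<^sub>R (f x)\<^sup>2 = (F x)\<^sup>2"
    using F_ae by (intro AE_completion) (auto elim!: eventually_mono simp: indicator_def)
  ultimately have "integrable lebesgue (\<lambda>x. (F x)\<^sup>2)"
    by (rule integrable_cong_AE_imp)
  then have F2: "integrable lborel (\<lambda>x. (F x)\<^sup>2)"
    by (subst (asm) integrable_completion) auto
  have "integrable lborel (\<lambda>x. indicator {0<..1::real} x + (F x)\<^sup>2 :: real)"
    using F2 by (intro Bochner_Integration.integrable_add) auto
  then have "integrable lborel F"
  proof (rule Bochner_Integration.integrable_bound)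
    have "\<bar>F x\<bar> \<le> indicator {0<..1} x + (F x)\<^sup>2" for x
    proof (cases "x \<in> {0<..1}")
      case True
      have "0 \<le> (\<bar>F x\<bar> - 1)\<^sup>2 + (F x)\<^sup>2 + 1" by simp
      then show ?thesis using True by (simp add: power2_diff)
    qed (simp add: F0)
    then show "AE x in lborel. norm (F x) \<le> norm (indicator {0<..1} x + (F x)\<^sup>2)"
      by (auto simp: abs_of_nonneg[OF add_nonneg_nonneg])
  qed simp
  then show ?thesis using that F F0 F_ae F2 by blast
qed

lemma integrable_tensor:
  fixes F G :: "real \<Rightarrow> real"
  assumes "integrable lborel F" "integrable lborel G"
  shows "integrable lborel (\<lambda>p. F (fst p) * G (snd p))"
proof -
  have [measurable]: "F \<in> borel_measurable borel" "G \<in> borel_measurable borel"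
    using assms by (auto dest: borel_measurable_integrable)
  have "integrable (lborel \<Otimes>\<^sub>M lborel) (\<lambda>p. F (fst p) * G (snd p))"
  proof (rule lborel_pair.Fubini_integrable)
    show "integrable lborel (\<lambda>x. \<integral>y. norm (F (fst (x, y)) * G (snd (x, y))) \<partial>lborel)"
      using assms(1) by (simp add: abs_mult)
    show "AE x in lborel. integrable lborel (\<lambda>y. F (fst (x, y)) * G (snd (x, y)))"
      using assms(2) by simp
  qed measurable
  then show ?thesis by (simp add: lborel_prod)
qed

lemma nn_integral_tensor_squares:
  fixes F G :: "real \<Rightarrow> real"
  assumes F: "integrable lborel (\<lambda>x. (F x)\<^sup>2)" and G: "integrable lborel (\<lambda>x. (G x)\<^sup>2)"
    and [measurable]: "F \<in> borel_measurable borel" "G \<in> borel_measurable borel"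
  shows "(\<integral>\<^sup>+x. ennreal ((F x)\<^sup>2) \<partial>lborel) * (\<integral>\<^sup>+y. ennreal ((G y)\<^sup>2) \<partial>lborel)
    = ennreal (\<integral>p. (F (fst p))\<^sup>2 * (G (snd p))\<^sup>2 \<partial>lborel)"
proof -
  have "ennreal (\<integral>p. (F (fst p))\<^sup>2 * (G (snd p))\<^sup>2 \<partial>lborel)
      = (\<integral>\<^sup>+p. ennreal ((F (fst p))\<^sup>2) * ennreal ((G (snd p))\<^sup>2) \<partial>lborel)"
    using integrable_tensor[OF F G] by (subst nn_integral_eq_integral[symmetric]) (auto simp: ennreal_mult)
  also have "\<dots> = (\<integral>\<^sup>+x. \<integral>\<^sup>+y. ennreal ((F x)\<^sup>2) * ennreal ((G y)\<^sup>2) \<partial>lborel \<partial>lborel)"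
    by (simp add: lborel_prod[symmetric] lborel.nn_integral_fst[symmetric] del: lborel_prod)
  also have "\<dots> = (\<integral>\<^sup>+x. ennreal ((F x)\<^sup>2) \<partial>lborel) * (\<integral>\<^sup>+y. ennreal ((G y)\<^sup>2) \<partial>lborel)"
    by (rule nn_integral_product_split) measurable
  finally show ?thesis by simp
qed


section \<open>The second moment bound\<close>

text \<open>Joint measurability of the sheet concerns the quadrant only; \<open>max 0\<close> extends the integrand to the
  whole plane without changing it on the quadrant.\<close>

lemma (in levy_sheet) scaled_trig_measurable:
  assumes jm: "jointly_measurable M L" and trig: "trig \<in> {cos, sin :: real \<Rightarrow> real}"
    and "0 \<le> s"
  shows "(\<lambda>(p, \<omega>). trig (\<theta> * L (s * max 0 (fst p), s * max 0 (snd p)) \<omega>))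
     \<in> borel_measurable ((lborel :: (real \<times> real) measure) \<Otimes>\<^sub>M M)"
proof -
  let ?\<phi> = "\<lambda>p :: real \<times> real. (s * max 0 (fst p), s * max 0 (snd p))"
  have "?\<phi> \<in> borel_measurable borel"
    unfolding borel_prod[symmetric] by measurable
  then have "?\<phi> \<in> measurable lborel (restrict_space borel quadrant)"
    using \<open>0 \<le> s\<close> by (auto simp: measurable_restrict_space2_iff)
  then have "(\<lambda>(p, \<omega>). (?\<phi> p, \<omega>)) \<in> measurable (lborel \<Otimes>\<^sub>M M) (restrict_space borel quadrant \<Otimes>\<^sub>M M)"
    by measurable
  from measurable_compose[OF this jm[unfolded jointly_measurable_def]]
  have [measurable]: "(\<lambda>(p, \<omega>). L (?\<phi> p) \<omega>) \<in> borel_measurable (lborel \<Otimes>\<^sub>M M)"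
    by (simp add: case_prod_beta)
  have [measurable]: "trig \<in> borel_measurable borel" using trig by auto
  show ?thesis by measurable
qed

lemma levy_khintchine_re_nonneg: "0 \<le> levy_khintchine_re \<sigma> \<eta> \<xi>"
  unfolding levy_khintchine_re_def by (intro add_nonneg_nonneg integral_nonneg) auto

lemma levy_khintchine_re_minus: "levy_khintchine_re \<sigma> \<eta> (- \<xi>) = levy_khintchine_re \<sigma> \<eta> \<xi>"
  by (simp add: levy_khintchine_re_def)

text \<open>Scaling both coordinates by \<open>s\<close> multiplies areas by \<open>s\<^sup>2\<close>, so the kernel estimate applies with
  \<open>c = r * s\<^sup>2\<close>. Pairs of points with a common coordinate, for which the grid of rectangles
  degenerates, are negligible.\<close>

lemma (in levy_sheet) second_moment_tensor_le:
  fixes F G :: "real \<Rightarrow> real"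
  assumes jm: "jointly_measurable M L" and "0 < r" "0 < s"
    and r: "Re (\<Psi> \<theta>) = r" "Re (\<Psi> (- \<theta>)) = r" and trig: "trig \<in> {cos, sin}"
    and [measurable]: "F \<in> borel_measurable borel" "G \<in> borel_measurable borel"
    and supp: "\<And>x. x \<notin> {0<..1} \<Longrightarrow> F x = 0" "\<And>x. x \<notin> {0<..1} \<Longrightarrow> G x = 0"
    and int: "integrable lborel F" "integrable lborel G"
    and int2: "integrable lborel (\<lambda>x. (F x)\<^sup>2)" "integrable lborel (\<lambda>x. (G x)\<^sup>2)"
  shows "expectation (\<lambda>\<omega>. (\<integral>p. (F (fst p) * G (snd p) * sqrt (fst p * snd p)) *
            trig (\<theta> * L (s * max 0 (fst p), s * max 0 (snd p)) \<omega>) \<partial>lborel)\<^sup>2)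
    \<le> 36 / (r * s\<^sup>2)\<^sup>2 * (\<integral>p. (F (fst p))\<^sup>2 * (G (snd p))\<^sup>2 \<partial>lborel)"
proof -
  define h where "h = (\<lambda>p. F (fst p) * G (snd p) * sqrt (fst p * snd p))"
  define X where "X = (\<lambda>p \<omega>. trig (\<theta> * L (s * max 0 (fst p), s * max 0 (snd p)) \<omega>))"
  let ?m = "\<lambda>p p'. min (snd p) (snd p') * \<bar>fst p - fst p'\<bar> + min (fst p) (fst p') * \<bar>snd p - snd p'\<bar>"
  let ?c = "r * s\<^sup>2"
  have h_int: "integrable lborel h"
  proof (rule Bochner_Integration.integrable_bound[OF integrable_tensor[OF int]])
    have "\<bar>h p\<bar> \<le> \<bar>F (fst p) * G (snd p)\<bar>" for p
    proof (cases "fst p \<in> {0<..1} \<and> snd p \<in> {0<..1}")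
      case True
      then have "0 \<le> fst p * snd p" "fst p * snd p \<le> 1" by (auto intro: mult_le_one)
      then show ?thesis by (auto simp: h_def abs_mult intro!: mult_left_le)
    qed (use supp in \<open>auto simp: h_def\<close>)
    then show "AE p in lborel. norm (h p) \<le> norm (F (fst p) * G (snd p))" by simp
    have "h \<in> borel_measurable borel"
      unfolding h_def borel_prod[symmetric] by measurable
    then show "h \<in> borel_measurable lborel" by simp
  qed
  have X_meas: "case_prod X \<in> borel_measurable (lborel \<Otimes>\<^sub>M M)"
    using scaled_trig_measurable[OF jm trig, of s \<theta>] \<open>0 < s\<close> by (simp add: X_def)
  have X_le: "\<bar>X p \<omega>\<bar> \<le> 1" for p \<omega>
    using trig by (auto simp: X_def)
  have corr: "\<bar>expectation (\<lambda>\<omega>. X p \<omega> * X p' \<omega>)\<bar> \<le> exp (- ?c * ?m p p')"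
    if pos: "0 < fst p" "0 < snd p" "0 < fst p'" "0 < snd p'"
      and ne: "fst p \<noteq> fst p'" "snd p \<noteq> snd p'" for p p'
  proof -
    have "\<bar>expectation (\<lambda>\<omega>. X p \<omega> * X p' \<omega>)\<bar> \<le>
       exp (- r * (min (s * snd p) (s * snd p') * \<bar>s * fst p - s * fst p'\<bar>
          + min (s * fst p) (s * fst p') * \<bar>s * snd p - s * snd p'\<bar>))"
      using trig_correlation_le[of "s * fst p" "s * snd p" "s * fst p'" "s * snd p'" \<theta> r trig]
        pos ne \<open>0 < s\<close> r trig by (simp add: X_def)
    also have "min (s * snd p) (s * snd p') * \<bar>s * fst p - s * fst p'\<bar>
          + min (s * fst p) (s * fst p') * \<bar>s * snd p - s * snd p'\<bar> = s\<^sup>2 * ?m p p'"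
    proof -
      have scale: "min (s * u) (s * v) = s * min u v" "\<bar>s * u - s * v\<bar> = s * \<bar>u - v\<bar>" for u v
        using \<open>0 < s\<close> by (auto simp: min_def abs_mult simp flip: right_diff_distrib)
      show ?thesis unfolding scale by (simp add: power2_eq_square algebra_simps)
    qed
    finally show ?thesis by (simp add: mult.assoc)
  qed
  have "ennreal (expectation (\<lambda>\<omega>. (\<integral>p. h p * X p \<omega> \<partial>lborel)\<^sup>2))
    \<le> (\<integral>\<^sup>+p. \<integral>\<^sup>+p'. ennreal (\<bar>h p * h p'\<bar> * \<bar>expectation (\<lambda>\<omega>. X p \<omega> * X p' \<omega>)\<bar>) \<partial>lborel \<partial>lborel)"
    by (rule second_moment_of_integral_le[OF lborel.sigma_finite_measure_axioms X_meas X_le h_int])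
  also have "\<dots> \<le> (\<integral>\<^sup>+p. \<integral>\<^sup>+p'. ennreal (\<bar>h p * h p'\<bar> * exp (- ?c * ?m p p')) \<partial>lborel \<partial>lborel)"
  proof (rule nn_integral_mono, rule nn_integral_mono_AE)
    fix p
    show "AE p' in lborel. ennreal (\<bar>h p * h p'\<bar> * \<bar>expectation (\<lambda>\<omega>. X p \<omega> * X p' \<omega>)\<bar>)
       \<le> ennreal (\<bar>h p * h p'\<bar> * exp (- ?c * ?m p p'))"
      using AE_lborel_pair[OF AE_lborel_singleton[of "fst p"] AE_lborel_singleton[of "snd p"]]
    proof eventually_elim
      case (elim p')
      show ?case
      proof (cases "0 < fst p \<and> 0 < snd p \<and> 0 < fst p' \<and> 0 < snd p'")
        case True
        then show ?thesis using corr[of p p'] elim by (intro ennreal_leI mult_left_mono) auto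
      next
        case False
        then have "h p = 0 \<or> h p' = 0"
          using supp by (auto simp: h_def)
        then show ?thesis by auto
      qed
    qed
  qed
  also have "\<dots> \<le> ennreal (36 / ?c\<^sup>2) *
      ((\<integral>\<^sup>+x. ennreal ((F x)\<^sup>2) \<partial>lborel) * (\<integral>\<^sup>+y. ennreal ((G y)\<^sup>2) \<partial>lborel))"
    unfolding h_def using supp \<open>0 < r\<close> \<open>0 < s\<close>
    by (intro kernel_form_le[unfolded case_prod_unfold]) auto
  also have "\<dots> = ennreal (36 / ?c\<^sup>2 * (\<integral>p. (F (fst p))\<^sup>2 * (G (snd p))\<^sup>2 \<partial>lborel))"
    unfolding nn_integral_tensor_squares[OF int2 assms(7,8)]
    by (rule ennreal_mult[symmetric]) (auto intro!: integral_nonneg)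
  finally show ?thesis
    by (subst (asm) ennreal_le_iff) (auto simp: h_def X_def intro!: mult_nonneg_nonneg integral_nonneg)
qed

theorem lemma4p2:
  fixes M :: "'a measure" and L :: "real \<times> real \<Rightarrow> 'a \<Rightarrow> real" and \<Psi> :: "real \<Rightarrow> complex"
    and a b :: "real \<Rightarrow> real" and a\<^sub>0 \<sigma> \<theta> K :: real and \<eta> :: "real measure"
    and f g :: "real \<Rightarrow> real" and n k :: nat
  assumes "levy_sheet M L \<Psi>" and "jointly_measurable M L"
    and "\<sigma> \<ge> 0" and "levy_measure \<eta>"
    and "a = levy_khintchine_re \<sigma> \<eta>" and "b = levy_khintchine_im a\<^sub>0 \<eta>"
    and "\<And>\<xi>. \<Psi> \<xi> = complex_of_real (a \<xi>) + \<i> * complex_of_real (b \<xi>)"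
    and "\<theta> \<in> {0<..<2 * pi}" and "a \<theta> * a (2 * \<theta>) \<noteq> 0"
    and "K = 1 / sqrt 2 * (((a \<theta>)\<^sup>2 + (b \<theta>)\<^sup>2) / a \<theta>)"
    and "square_integrable_01 f" and "square_integrable_01 g"
    and "k \<in> {1, 2}"
  shows "prob_space.expectation M (\<lambda>\<omega>.
           (LINT p:{0..1}\<times>{0..1}|lebesgue.
              f (fst p) * g (snd p) * theta_process K \<theta> L k n (fst p) (snd p) \<omega>)\<^sup>2)
         \<le> 136 / (a \<theta>)\<^sup>2 * K\<^sup>2 *
             (LINT p:{0..1}\<times>{0..1}|lebesgue. (f (fst p))\<^sup>2 * (g (snd p))\<^sup>2)"
proof -
  interpret levy_sheet M L \<Psi> by fact
  obtain F where F[measurable]: "F \<in> borel_measurable borel" "\<And>x. x \<notin> {0<..1} \<Longrightarrow> F x = 0"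
    "AE x in lborel. F x = indicator {0..1} x * f x"
    "integrable lborel F" "integrable lborel (\<lambda>x. (F x)\<^sup>2)"
    by (rule square_integrable_01_borel_version[OF assms(11)]) (rule that; assumption)
  obtain G where G[measurable]: "G \<in> borel_measurable borel" "\<And>x. x \<notin> {0<..1} \<Longrightarrow> G x = 0"
    "AE x in lborel. G x = indicator {0..1} x * g x"
    "integrable lborel G" "integrable lborel (\<lambda>x. (G x)\<^sup>2)"
    by (rule square_integrable_01_borel_version[OF assms(12)]) (rule that; assumption)
  define trig where "trig = (if k = 1 then cos else sin :: real \<Rightarrow> real)"
  have trig: "trig \<in> {cos, sin}" by (simp add: trig_def)
  define s where "s = sqrt (real n)"
  let ?I = "\<integral>p. (F (fst p))\<^sup>2 * (G (snd p))\<^sup>2 \<partial>lborel"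
  let ?V = "\<lambda>\<omega>. \<integral>p. (F (fst p) * G (snd p) * sqrt (fst p * snd p)) *
            trig (\<theta> * L (s * max 0 (fst p), s * max 0 (snd p)) \<omega>) \<partial>lborel"
  have ae: "AE p in (lborel :: (real \<times> real) measure).
      F (fst p) = indicator {0..1} (fst p) * f (fst p) \<and> G (snd p) = indicator {0..1} (snd p) * g (snd p)"
    by (rule AE_lborel_pair[OF F(3) G(3)])
  have "0 < a \<theta>"
    using levy_khintchine_re_nonneg[of \<sigma> \<eta> \<theta>] assms(5,9) by (auto simp: less_le)
  have rhs: "(LINT p:{0..1}\<times>{0..1}|lebesgue. (f (fst p))\<^sup>2 * (g (snd p))\<^sup>2) = ?I"
    unfolding set_lebesgue_integral_def
  proof (rule integral_lebesgue_eq_lborel)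
    show "AE p in lborel. (F (fst p))\<^sup>2 * (G (snd p))\<^sup>2
        = indicator ({0..1} \<times> {0..1}) p *\<^sub>R ((f (fst p))\<^sup>2 * (g (snd p))\<^sup>2)"
      using ae by eventually_elim (auto simp: indicator_def)
  qed (unfold borel_prod[symmetric], measurable)
  have lhs: "(LINT p:{0..1}\<times>{0..1}|lebesgue.
        f (fst p) * g (snd p) * theta_process K \<theta> L k n (fst p) (snd p) \<omega>) = real n * K * ?V \<omega>"
    if \<omega>: "\<omega> \<in> space M" for \<omega>
  proof -
    have X[measurable]: "(\<lambda>p. trig (\<theta> * L (s * max 0 (fst p), s * max 0 (snd p)) \<omega>))
        \<in> borel_measurable (borel \<Otimes>\<^sub>M borel)"
      using measurable_Pair1[OF scaled_trig_measurable[OF assms(2) trig, of s \<theta>] ] \<omega>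
      by (simp add: s_def borel_prod)
    have "(LINT p:{0..1}\<times>{0..1}|lebesgue.
        f (fst p) * g (snd p) * theta_process K \<theta> L k n (fst p) (snd p) \<omega>) =
      (\<integral>p. real n * K * ((F (fst p) * G (snd p) * sqrt (fst p * snd p)) *
            trig (\<theta> * L (s * max 0 (fst p), s * max 0 (snd p)) \<omega>)) \<partial>lborel)"
      unfolding set_lebesgue_integral_def
    proof (rule integral_lebesgue_eq_lborel)
      show "AE p in lborel. real n * K * ((F (fst p) * G (snd p) * sqrt (fst p * snd p)) *
            trig (\<theta> * L (s * max 0 (fst p), s * max 0 (snd p)) \<omega>)) =
         indicator ({0..1} \<times> {0..1}) p *\<^sub>R
           (f (fst p) * g (snd p) * theta_process K \<theta> L k n (fst p) (snd p) \<omega>)"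
        using ae
      proof eventually_elim
        case (elim p)
        then show ?case
          by (cases p) (auto simp: theta_process_def trig_def s_def indicator_def)
      qed
    qed (unfold borel_prod[symmetric], measurable)
    then show ?thesis by simp
  qed
  have "expectation (\<lambda>\<omega>. (LINT p:{0..1}\<times>{0..1}|lebesgue.
              f (fst p) * g (snd p) * theta_process K \<theta> L k n (fst p) (snd p) \<omega>)\<^sup>2)
    = expectation (\<lambda>\<omega>. (real n * K)\<^sup>2 * (?V \<omega>)\<^sup>2)"
    by (intro Bochner_Integration.integral_cong refl) (simp only: lhs power_mult_distrib)
  also have "\<dots> = (real n * K)\<^sup>2 * expectation (\<lambda>\<omega>. (?V \<omega>)\<^sup>2)"
    by simp
  \<comment> \<open>The factor \<open>n\<^sup>2\<close> cancels against \<open>s\<^sup>4 = n\<^sup>2\<close> in the denominator.\<close>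
  also have "\<dots> \<le> 36 / (a \<theta>)\<^sup>2 * K\<^sup>2 * ?I"
  proof (cases "n = 0")
    case True
    then show ?thesis by (auto intro!: mult_nonneg_nonneg divide_nonneg_nonneg integral_nonneg)
  next
    case False
    then have "0 < s" "s\<^sup>2 = real n" by (simp_all add: s_def)
    have "expectation (\<lambda>\<omega>. (?V \<omega>)\<^sup>2) \<le> 36 / (a \<theta> * s\<^sup>2)\<^sup>2 * ?I"
      using assms(7) levy_khintchine_re_minus[of \<sigma> \<eta> \<theta>] assms(5)
      by (intro second_moment_tensor_le[OF assms(2) \<open>0 < a \<theta>\<close> \<open>0 < s\<close> _ _ trig F(1) G(1) F(2) G(2)
          F(4) G(4) F(5) G(5)]) auto
    then have "(real n * K)\<^sup>2 * expectation (\<lambda>\<omega>. (?V \<omega>)\<^sup>2) \<le> (real n * K)\<^sup>2 * (36 / (a \<theta> * s\<^sup>2)\<^sup>2 * ?I)"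
      by (rule mult_left_mono) simp
    also have "\<dots> = 36 / (a \<theta>)\<^sup>2 * K\<^sup>2 * ?I"
      unfolding \<open>s\<^sup>2 = real n\<close> using False by (simp add: power_mult_distrib)
    finally show ?thesis .
  qed
  also have "\<dots> \<le> 136 / (a \<theta>)\<^sup>2 * K\<^sup>2 * ?I"
    by (intro mult_right_mono divide_right_mono integral_nonneg) auto
  finally show ?thesis unfolding rhs .
qed

end
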